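(* Let $G$ be a torsion-free abelian group (written additively) and let $S$ be a finite subset of $G$ with $S=-S$. Let $H=\mathrm{Cayley}(G,S)$. Suppose that for every $x\in G$, every $s\in S$ and every integer $n\geq1$, the graph distance in $H$ satisfies $d_H(x,x+ns)=n$. Then $H$ is Ricci-flat.
   Context: $\mathrm{Cayley}(G,S)$ has vertex set $G$, with $x\sim y$ iff $y-x\in S$. For a vertex $x$ let $\Gamma(x)$ be its neighbors, $d_x=|\Gamma(x)|$, and $d$ the graph distance. For $\alpha\in[0,1]$ let $m_x^\alpha(x)=\alpha$, $m_x^\alpha(v)=\frac{1-\alpha}{d_x}$ for $v\in\Gamma(x)$, $0$ otherwise. $W(m_1,m_2)=\inf_A\sum A(x,y)d(x,y)$ over couplings $A$ of $m_1,m_2$ (nonnegative $A$ with marginals $m_1,m_2$). $\kappa_\alpha(x,y)=1-\frac{W(m_x^\alpha,m_y^\alpha)}{d(x,y)}$, $\kappa(x,y)=\lim_{\alpha\to1}\frac{\kappa_\alpha(x,y)}{1-\alpha}$. A graph is Ricci-flat if $\kappa(x,y)=0$ for every edge $xy$. *)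

theory Defs
  imports "HOL-Analysis.Analysis"
begin

definition nat_multiple :: "nat \<Rightarrow> 'a::comm_monoid_add \<Rightarrow> 'a" where
  "nat_multiple n a = (\<Sum>i<n. a)"

text \<open>
  Groups are types of class \<^class>\<open>ab_group_add\<close>; torsion-freeness is a property of the type.
\<close>

definition torsion_free :: "'a::ab_group_add itself \<Rightarrow> bool" where
  "torsion_free _ \<longleftrightarrow> (\<forall>(a::'a) n. n \<ge> 1 \<longrightarrow> nat_multiple n a = 0 \<longrightarrow> a = 0)"

text \<open>
  A graph is given by its adjacency relation \<open>E\<close> on the vertex type. The relational power
  \<open>(E ^^ n) x y\<close> says that there is a walk with \<open>n\<close> edges from \<open>x\<close> to \<open>y\<close>, so the distance is
  \<open>\<infinity>\<close> between different components.
\<close>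

definition cayley :: "'a::ab_group_add set \<Rightarrow> 'a \<Rightarrow> 'a \<Rightarrow> bool" where
  "cayley S x y \<longleftrightarrow> y - x \<in> S"

definition graph_dist :: "('a \<Rightarrow> 'a \<Rightarrow> bool) \<Rightarrow> 'a \<Rightarrow> 'a \<Rightarrow> enat" where
  "graph_dist E x y = (INF n\<in>{n. (E ^^ n) x y}. enat n)"

definition neighbors :: "('a \<Rightarrow> 'a \<Rightarrow> bool) \<Rightarrow> 'a \<Rightarrow> 'a set" where
  "neighbors E x = {v. E x v}"

definition lazy_walk :: "('a \<Rightarrow> 'a \<Rightarrow> bool) \<Rightarrow> real \<Rightarrow> 'a \<Rightarrow> 'a \<Rightarrow> real" where
  "lazy_walk E \<alpha> x v =
     (if v = x then \<alpha>
      else if v \<in> neighbors E x then (1 - \<alpha>) / real (card (neighbors E x))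
      else 0)"

definition is_coupling :: "('a \<Rightarrow> real) \<Rightarrow> ('a \<Rightarrow> real) \<Rightarrow> ('a \<Rightarrow> 'a \<Rightarrow> real) \<Rightarrow> bool" where
  "is_coupling m1 m2 A \<longleftrightarrow>
     (\<forall>u v. 0 \<le> A u v) \<and>
     (\<forall>u. ((\<lambda>v. A u v) has_sum m1 u) UNIV) \<and>
     (\<forall>v. ((\<lambda>u. A u v) has_sum m2 v) UNIV)"

text \<open>
  Costs live in \<^typ>\<open>ennreal\<close>, where \<open>0 * \<infinity> = 0\<close>: a coupling moving positive mass between
  different components has cost \<open>\<infinity>\<close>.
\<close>

definition transport_cost :: "('a \<Rightarrow> 'a \<Rightarrow> bool) \<Rightarrow> ('a \<Rightarrow> 'a \<Rightarrow> real) \<Rightarrow> ennreal" where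
  "transport_cost E A =
     (\<Sum>\<^sub>\<infinity>(u, v)\<in>UNIV. ennreal (A u v) * ennreal_of_enat (graph_dist E u v))"

definition wasserstein :: "('a \<Rightarrow> 'a \<Rightarrow> bool) \<Rightarrow> ('a \<Rightarrow> real) \<Rightarrow> ('a \<Rightarrow> real) \<Rightarrow> ennreal" where
  "wasserstein E m1 m2 = Inf {transport_cost E A | A. is_coupling m1 m2 A}"

text \<open>
  The conversions to \<^typ>\<open>real\<close> lose nothing when \<open>x \<noteq> y\<close> lie in one component of a locally
  finite symmetric graph without loops and \<open>0 \<le> \<alpha> \<le> 1\<close>: both the Wasserstein distance and the
  graph distance are then finite.
\<close>

definition alpha_curvature :: "('a \<Rightarrow> 'a \<Rightarrow> bool) \<Rightarrow> real \<Rightarrow> 'a \<Rightarrow> 'a \<Rightarrow> real" where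
  "alpha_curvature E \<alpha> x y =
     1 - enn2real (wasserstein E (lazy_walk E \<alpha> x) (lazy_walk E \<alpha> y))
           / real (the_enat (graph_dist E x y))"

text \<open>
  As a relation, so that a curvature value includes the existence of the limit. The limit is
  one-sided because \<open>\<alpha>\<close> ranges over \<open>[0, 1]\<close>.
\<close>

definition has_ricci_curvature :: "('a \<Rightarrow> 'a \<Rightarrow> bool) \<Rightarrow> 'a \<Rightarrow> 'a \<Rightarrow> real \<Rightarrow> bool" where
  "has_ricci_curvature E x y k \<longleftrightarrow>
     ((\<lambda>\<alpha>. alpha_curvature E \<alpha> x y / (1 - \<alpha>)) \<longlongrightarrow> k) (at_left 1)"

definition ricci_flat :: "('a \<Rightarrow> 'a \<Rightarrow> bool) \<Rightarrow> bool" where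
  "ricci_flat E \<longleftrightarrow> (\<forall>x y. E x y \<longrightarrow> has_ricci_curvature E x y 0)"

end

theory Submission
  imports Defs
begin

text \<open>
  For an edge from \<open>x\<close> to \<open>y = x + s\<close> the measure at \<open>y\<close> is the translate by \<open>s\<close> of the measure
  at \<open>x\<close>, and translation by \<open>s\<close> moves every point by distance \<open>1\<close>; hence \<open>W \<le> 1\<close>. Conversely,
  since \<open>N \<mapsto> - N s\<close> is a geodesic ray, it has a Busemann function
  \<open>h z = inf\<^sub>N (d (x, z + N s) - N)\<close>, which is 1-Lipschitz and satisfies \<open>h (z + s) = h z + 1\<close>.
  Testing any coupling against \<open>h\<close> gives \<open>W \<ge> 1\<close>. So the \<open>\<alpha>\<close>-curvature vanishes for every \<open>\<alpha>\<close>.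
\<close>

section \<open>Multiples, walks and distances in Cayley graphs\<close>

lemma nat_multiple_0 [simp]: "nat_multiple 0 a = 0"
  by (simp add: nat_multiple_def)

lemma nat_multiple_Suc: "nat_multiple (Suc n) a = nat_multiple n a + a"
  by (simp add: nat_multiple_def)

lemma graph_dist_le_walk: "(E ^^ n) x y \<Longrightarrow> graph_dist E x y \<le> enat n"
  unfolding graph_dist_def by (rule INF_lower) simp

text \<open>Natural numbers are well-ordered, so the infimum is attained by a shortest walk if any
  walk exists; otherwise it runs over the empty set and is infinite.\<close>

lemma le_graph_distI:
  assumes "\<And>n. (E ^^ n) x y \<Longrightarrow> c \<le> real n"
  shows "ennreal c \<le> ennreal_of_enat (graph_dist E x y)"
proof (cases "\<exists>n. (E ^^ n) x y")
  case True
  then have "graph_dist E x y \<in> enat ` {n. (E ^^ n) x y}"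
    unfolding graph_dist_def by (blast intro: wellorder_InfI)
  then obtain n where "(E ^^ n) x y" "graph_dist E x y = enat n"
    by auto
  then show ?thesis
    using assms[of n] by (simp add: ennreal_of_nat_eq_real_of_nat ennreal_leI)
next
  case False
  then show ?thesis
    by (simp add: graph_dist_def top_enat_def)
qed

lemma cayley_walk_translate:
  "(cayley S ^^ n) x y \<Longrightarrow> (cayley S ^^ n) (x + c) (y + c)"
proof (induction n arbitrary: y)
  case (Suc n)
  then obtain z where "(cayley S ^^ n) x z" "cayley S z y"
    by auto
  moreover from this(2) have "cayley S (z + c) (y + c)"
    by (simp add: cayley_def)
  ultimately show ?case
    using Suc.IH by auto
qed simp

lemma cayley_walk_sym:
  assumes "S = uminus ` S" "(cayley S ^^ n) x y"
  shows "(cayley S ^^ n) y x"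
  using assms(2)
proof (induction n arbitrary: y)
  case (Suc n)
  then obtain z where "(cayley S ^^ n) x z" "cayley S z y"
    by auto
  moreover from this(2) have "cayley S y z"
    using assms(1) unfolding cayley_def by (metis image_eqI minus_diff_eq)
  ultimately show ?case
    using Suc.IH relpowp_Suc_I2 by metis
qed simp

section \<open>Lower and upper bounds for transport costs\<close>

text \<open>The easy half of Kantorovich duality for finitely supported measures. The test function
  \<open>f\<close> has to be 1-Lipschitz only in one direction and only from the first support to
  the second.\<close>

lemma transport_cost_ge:
  assumes A: "is_coupling m1 m2 A"
    and F: "finite F" "\<And>u. u \<notin> F \<Longrightarrow> m1 u = 0"
    and G: "finite G" "\<And>v. v \<notin> G \<Longrightarrow> m2 v = 0"
    and f: "\<And>u v. u \<in> F \<Longrightarrow> v \<in> G \<Longrightarrow>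
              ennreal (f v - f u) \<le> ennreal_of_enat (graph_dist E u v)"
  shows "ennreal ((\<Sum>v\<in>G. m2 v * f v) - (\<Sum>u\<in>F. m1 u * f u)) \<le> transport_cost E A"
proof -
  have nn: "A u v \<ge> 0"
    and rows: "(A u has_sum m1 u) UNIV"
    and cols: "((\<lambda>u. A u v) has_sum m2 v) UNIV" for u v
    using A by (auto simp: is_coupling_def)
  have le1: "A u v \<le> m1 u" for u v
    using finite_sum_le_has_sum[OF rows, of "{v}"] nn by simp
  have le2: "A u v \<le> m2 v" for u v
    using finite_sum_le_has_sum[OF cols, of "{u}"] nn by simp
  \<comment> \<open>Each entry lies below both of its marginals, so the coupling lives on
    \<open>F \<times> G\<close> and the marginal conditions become finite sums.\<close>
  have A0: "A u v = 0" if "u \<notin> F \<or> v \<notin> G" for u v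
    using that F(2) G(2) le1[of u v] le2[of u v] nn[of u v] by fastforce
  have row: "(\<Sum>v\<in>G. A u v) = m1 u" for u
    by (rule has_sum_unique[OF _ rows], rule has_sum_finite_neutralI) (use G(1) A0 in auto)
  have col: "(\<Sum>u\<in>F. A u v) = m2 v" for v
    by (rule has_sum_unique[OF _ cols], rule has_sum_finite_neutralI) (use F(1) A0 in auto)
  have "(\<Sum>v\<in>G. m2 v * f v) - (\<Sum>u\<in>F. m1 u * f u)
      = (\<Sum>v\<in>G. \<Sum>u\<in>F. A u v * f v) - (\<Sum>u\<in>F. \<Sum>v\<in>G. A u v * f u)"
    by (simp add: sum_distrib_right flip: row col)
  also have "\<dots> = (\<Sum>u\<in>F. \<Sum>v\<in>G. A u v * (f v - f u))"
    by (subst sum.swap) (simp add: sum_subtractf algebra_simps)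
  also have "\<dots> = (\<Sum>(u,v)\<in>F \<times> G. A u v * (f v - f u))"
    by (simp add: sum.cartesian_product)
  \<comment> \<open>\<open>ennreal\<close> sends negative reals to 0 and distributes over sums of
    nonnegative terms only; hence the truncation before the sum is split.\<close>
  also have "ennreal \<dots> \<le> ennreal (\<Sum>(u,v)\<in>F \<times> G. A u v * max 0 (f v - f u))"
    using nn by (intro ennreal_leI sum_mono) (auto intro: mult_left_mono)
  also have "\<dots> = (\<Sum>(u,v)\<in>F \<times> G. ennreal (A u v * max 0 (f v - f u)))"
    using nn by (subst sum_ennreal[symmetric]) (auto simp: case_prod_unfold)
  also have "\<dots> \<le> (\<Sum>(u,v)\<in>F \<times> G. ennreal (A u v) * ennreal_of_enat (graph_dist E u v))"
  proof (intro sum_mono, clarify)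
    fix u v assume "u \<in> F" "v \<in> G"
    then have "ennreal (max 0 (f v - f u)) \<le> ennreal_of_enat (graph_dist E u v)"
      using f by (auto simp: max_def)
    then show "ennreal (A u v * max 0 (f v - f u))
        \<le> ennreal (A u v) * ennreal_of_enat (graph_dist E u v)"
      using nn by (simp add: ennreal_mult mult_left_mono)
  qed
  \<comment> \<open>An infinite sum in \<open>ennreal\<close> is the supremum of its finite partial
    sums, and \<open>F \<times> G\<close> gives one of them.\<close>
  also have "\<dots> \<le> transport_cost E A"
    unfolding transport_cost_def
    by (subst nonneg_infsum_complete) (use F(1) G(1) in \<open>auto intro!: SUP_upper\<close>)
  finally show ?thesis .
qed

text \<open>All mass at \<open>u\<close> is sent to \<open>u + s\<close>, so every row and every
  column has at most one nonzero entry. This is the plan that gives the upper bound.\<close>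

lemma translation_coupling:
  fixes m :: "'a::ab_group_add \<Rightarrow> real"
  assumes "\<And>u. m u \<ge> 0"
  shows "is_coupling m (\<lambda>v. m (v - s)) (\<lambda>u v. if v = u + s then m u else 0)"
  unfolding is_coupling_def
proof (intro conjI allI)
  fix u v
  show "((\<lambda>v. if v = u + s then m u else 0) has_sum m u) UNIV"
    by (rule has_sum_finite_neutralI[where B = "{u + s}"]) auto
  show "((\<lambda>u. if v = u + s then m u else 0) has_sum m (v - s)) UNIV"
    by (rule has_sum_finite_neutralI[where B = "{v - s}"]) auto
qed (use assms in auto)

lemma transport_cost_translation:
  fixes m :: "'a::ab_group_add \<Rightarrow> real"
  assumes "finite F" "\<And>u. u \<notin> F \<Longrightarrow> m u = 0" "\<And>u. m u \<ge> 0"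
    and "\<And>u. graph_dist E u (u + s) = 1"
  shows "transport_cost E (\<lambda>u v. if v = u + s then m u else 0) = ennreal (\<Sum>u\<in>F. m u)"
proof -
  have "((\<lambda>(u, v). ennreal (if v = u + s then m u else 0) * ennreal_of_enat (graph_dist E u v))
      has_sum (\<Sum>u\<in>F. ennreal (m u))) UNIV"
  proof (rule has_sum_finite_neutralI[where B = "(\<lambda>u. (u, u + s)) ` F"])
    have "inj_on (\<lambda>u. (u, u + s)) F"
      by (auto intro: inj_onI)
    then show "(\<Sum>u\<in>F. ennreal (m u)) = (\<Sum>(u, v)\<in>(\<lambda>u. (u, u + s)) ` F.
        ennreal (if v = u + s then m u else 0) * ennreal_of_enat (graph_dist E u v))"
      by (simp add: sum.reindex assms(4))
  next
    show "(case p of (u, v) \<Rightarrow>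
        ennreal (if v = u + s then m u else 0) * ennreal_of_enat (graph_dist E u v)) = 0"
      if "p \<in> UNIV - (\<lambda>u. (u, u + s)) ` F" for p
      using that assms(2)[of "fst p"] by (cases p) (auto simp: image_iff)
  qed (use assms(1) in auto)
  then show ?thesis
    unfolding transport_cost_def using assms(3) by (simp add: infsumI)
qed

section \<open>Lazy random walks on Cayley graphs\<close>

lemma neighbors_cayley: "neighbors (cayley S) x = (\<lambda>t. x + t) ` S"
  by (auto simp: neighbors_def cayley_def image_iff intro!: bexI[where x = "_ - x"])

lemma card_neighbors_cayley: "card (neighbors (cayley S) x) = card S"
  by (simp add: neighbors_cayley card_image)

lemma lazy_walk_cayley_translate:
  "lazy_walk (cayley S) \<alpha> (x + s) v = lazy_walk (cayley S) \<alpha> x (v - s)"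
proof -
  have "v \<in> neighbors (cayley S) (x + s) \<longleftrightarrow> v - s \<in> neighbors (cayley S) x"
    by (simp add: neighbors_def cayley_def algebra_simps)
  then show ?thesis
    by (auto simp: lazy_walk_def card_neighbors_cayley algebra_simps)
qed

text \<open>A loop at \<open>x\<close> would lose the share of mass belonging to it, since
  \<open>lazy_walk\<close> gives \<open>x\<close> exactly \<alpha>; an empty neighborhood would lose
  all of 1 - \<alpha>.\<close>

lemma sum_lazy_walk:
  assumes "finite (neighbors E x)" "neighbors E x \<noteq> {}" "x \<notin> neighbors E x"
  shows "(\<Sum>v\<in>insert x (neighbors E x). lazy_walk E \<alpha> x v) = 1"
proof -
  have "(\<Sum>v\<in>neighbors E x. lazy_walk E \<alpha> x v)
      = (\<Sum>v\<in>neighbors E x. (1 - \<alpha>) / real (card (neighbors E x)))"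
    using assms(3) by (intro sum.cong) (auto simp: lazy_walk_def)
  also have "\<dots> = 1 - \<alpha>"
    using assms(1,2) by simp
  finally show ?thesis
    using assms(1,3) by (simp add: lazy_walk_def)
qed

section \<open>Busemann functions of the generator rays\<close>

locale geodesic_cayley =
  fixes S :: "'a::ab_group_add set"
  assumes finite: "finite S"
    and sym: "S = uminus ` S"
    and geodesic: "\<And>x s n. s \<in> S \<Longrightarrow> n \<ge> 1 \<Longrightarrow>
           graph_dist (cayley S) x (x + nat_multiple n s) = enat n"
begin

lemma walk_multiple_ge:
  assumes "s \<in> S" "(cayley S ^^ n) z (z + nat_multiple N s)"
  shows "N \<le> n"
proof (cases "N = 0")
  case False
  then show ?thesis
    using geodesic[of s N z] graph_dist_le_walk[OF assms(2)] assms(1) by simp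
qed simp

lemma dist_generator: "s \<in> S \<Longrightarrow> graph_dist (cayley S) x (x + s) = 1"
  using geodesic[of s 1 x] by (simp add: nat_multiple_Suc[of 0, simplified] one_enat_def)

text \<open>If 0 were a generator, its first multiple would put 0 at distance 1 from itself, yet the
  empty walk has length 0.\<close>

lemma zero_notin: "0 \<notin> S"
  using walk_multiple_ge[of 0 0 0 1] by (auto simp: nat_multiple_def)

text \<open>Lengths of arbitrary walks stand in for the distance from \<open>x\<close> to
  \<open>z + N s\<close>: the infimum is the same, and all values are real. The set can be empty
  when \<open>z\<close> is not reachable from \<open>x\<close>, so the lemmas below assume a walk
  from \<open>x\<close> to \<open>z\<close>.\<close>

definition busemann_set :: "'a \<Rightarrow> 'a \<Rightarrow> 'a \<Rightarrow> real set" where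
  "busemann_set s x z =
     {real n - real N | n N. (cayley S ^^ n) x (z + nat_multiple N s)}"

definition busemann :: "'a \<Rightarrow> 'a \<Rightarrow> 'a \<Rightarrow> real" where
  "busemann s x z = Inf (busemann_set s x z)"

lemma busemann_set_nonempty:
  assumes "(cayley S ^^ n) x z"
  shows "busemann_set s x z \<noteq> {}"
proof -
  have "(cayley S ^^ n) x (z + nat_multiple 0 s)"
    using assms by simp
  then show ?thesis
    unfolding busemann_set_def by blast
qed

text \<open>A walk back from \<open>z\<close> to \<open>x\<close>, followed by the given one, joins
  \<open>z\<close> to \<open>z + N s\<close> in \<open>m + n\<close> steps; the geodesic hypothesis
  forces \<open>N \<le> m + n\<close>. Thus the infimum is a genuine one.\<close>

lemma busemann_set_ge:
  assumes s: "s \<in> S" and m: "(cayley S ^^ m) x z" and r: "r \<in> busemann_set s x z"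
  shows "r \<ge> - real m"
proof -
  obtain n N where r: "r = real n - real N" "(cayley S ^^ n) x (z + nat_multiple N s)"
    using r by (auto simp: busemann_set_def)
  have "(cayley S ^^ (m + n)) z (z + nat_multiple N s)"
    using cayley_walk_sym[OF sym m] r(2) by (auto simp: relpowp_add)
  then have "N \<le> m + n"
    by (rule walk_multiple_ge[OF s])
  then show ?thesis
    using r(1) by simp
qed

lemma bdd_below_busemann_set:
  "s \<in> S \<Longrightarrow> (cayley S ^^ m) x z \<Longrightarrow> bdd_below (busemann_set s x z)"
  using busemann_set_ge by (meson bdd_belowI)

lemma busemann_lipschitz:
  assumes s: "s \<in> S" and z: "(cayley S ^^ m) x z" and w: "(cayley S ^^ k) z w"
  shows "busemann s x w - busemann s x z \<le> real k"
proof -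
  have xw: "(cayley S ^^ (m + k)) x w"
    using z w by (auto simp: relpowp_add)
  have "busemann s x w - real k \<le> busemann s x z"
    unfolding busemann_def[of s x z]
  proof (rule cInf_greatest)
    fix r assume "r \<in> busemann_set s x z"
    then obtain n N where r: "r = real n - real N" "(cayley S ^^ n) x (z + nat_multiple N s)"
      by (auto simp: busemann_set_def)
    \<comment> \<open>The walk from \<open>z\<close> to \<open>w\<close>, translated by
      \<open>N s\<close>, extends the walk that ends at \<open>z + N s\<close>.\<close>
    have "(cayley S ^^ (n + k)) x (w + nat_multiple N s)"
      using r(2) cayley_walk_translate[OF w] by (auto simp: relpowp_add)
    then have "real (n + k) - real N \<in> busemann_set s x w"
      unfolding busemann_set_def by blast
    then have "busemann s x w \<le> real (n + k) - real N"
      unfolding busemann_def by (rule cInf_lower) (rule bdd_below_busemann_set[OF s xw])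
    then show "busemann s x w - real k \<le> r"
      using r(1) by simp
  qed (rule busemann_set_nonempty[OF z])
  then show ?thesis by simp
qed

text \<open>One inequality is the Lipschitz bound along the edge. For the other, \<open>N\<close>
  steps along the ray from \<open>z + s\<close> are \<open>N + 1\<close> steps from
  \<open>z\<close>, which lowers the value by 1.\<close>

lemma busemann_add_generator:
  assumes s: "s \<in> S" and z: "(cayley S ^^ m) x z"
  shows "busemann s x (z + s) = busemann s x z + 1"
proof (rule antisym)
  have edge: "(cayley S ^^ 1) z (z + s)"
    using s by (auto simp: cayley_def relpowp_1)
  show "busemann s x (z + s) \<le> busemann s x z + 1"
    using busemann_lipschitz[OF s z edge] by simp
  have xzs: "(cayley S ^^ (m + 1)) x (z + s)"
    using z edge unfolding relpowp_add by blast
  show "busemann s x z + 1 \<le> busemann s x (z + s)"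
    unfolding busemann_def[of s x "z + s"]
  proof (rule cInf_greatest)
    fix r assume "r \<in> busemann_set s x (z + s)"
    then obtain n N where r: "r = real n - real N" "(cayley S ^^ n) x (z + s + nat_multiple N s)"
      by (auto simp: busemann_set_def)
    then have "(cayley S ^^ n) x (z + nat_multiple (Suc N) s)"
      by (simp add: nat_multiple_Suc algebra_simps)
    then have "real n - real (Suc N) \<in> busemann_set s x z"
      unfolding busemann_set_def by blast
    then have "busemann s x z \<le> real n - real (Suc N)"
      unfolding busemann_def by (rule cInf_lower) (rule bdd_below_busemann_set[OF s z])
    then show "busemann s x z + 1 \<le> r"
      using r(1) by simp
  qed (rule busemann_set_nonempty[OF xzs])
qed

section \<open>Wasserstein distance and curvature of edges\<close>

lemma wasserstein_edge:
  assumes s: "s \<in> S" and \<alpha>: "0 \<le> \<alpha>" "\<alpha> \<le> 1"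
  shows "wasserstein (cayley S) (lazy_walk (cayley S) \<alpha> x) (lazy_walk (cayley S) \<alpha> (x + s)) = 1"
proof -
  define m where "m = lazy_walk (cayley S) \<alpha> x"
  define F where "F = insert x (neighbors (cayley S) x)"
  have trans: "lazy_walk (cayley S) \<alpha> (x + s) = (\<lambda>v. m (v - s))"
    by (auto simp: m_def lazy_walk_cayley_translate)
  have F: "finite F"
    by (simp add: F_def neighbors_cayley finite)
  have m0: "m u = 0" if "u \<notin> F" for u
    using that by (auto simp: F_def m_def lazy_walk_def)
  have nn: "m u \<ge> 0" for u
    using \<alpha> by (auto simp: m_def lazy_walk_def)
  have total: "(\<Sum>u\<in>F. m u) = 1"
    unfolding F_def m_def
    by (rule sum_lazy_walk) (use s zero_notin finite in \<open>auto simp: neighbors_cayley\<close>)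
  \<comment> \<open>Every point of the support is within one step of \<open>x\<close>, so the lemmas
    on \<open>busemann\<close> apply there.\<close>
  have walk: "\<exists>k. (cayley S ^^ k) x u" if u: "u \<in> F" for u
  proof (cases "u = x")
    case True
    then show ?thesis by (auto intro: exI[of _ 0])
  next
    case False
    then have "(cayley S ^^ 1) x u"
      using u unfolding relpowp_1 by (simp add: F_def neighbors_def)
    then show ?thesis by blast
  qed
  let ?G = "(\<lambda>u. u + s) ` F"
  have lower: "1 \<le> transport_cost (cayley S) A"
    if A: "is_coupling m (\<lambda>v. m (v - s)) A" for A
  proof -
    have "(\<Sum>v\<in>?G. m (v - s) * busemann s x v) - (\<Sum>u\<in>F. m u * busemann s x u)
        = (\<Sum>u\<in>F. m u * busemann s x (u + s)) - (\<Sum>u\<in>F. m u * busemann s x u)"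
      by (simp add: sum.reindex)
    also have "\<dots> = (\<Sum>u\<in>F. m u * (busemann s x (u + s) - busemann s x u))"
      by (simp add: sum_subtractf right_diff_distrib)
    \<comment> \<open>Every unit of mass gains exactly 1 in \<open>busemann\<close> under
      translation by \<open>s\<close>.\<close>
    also have "\<dots> = (\<Sum>u\<in>F. m u)"
      using walk busemann_add_generator[OF s] by (intro sum.cong) fastforce+
    finally have "(\<Sum>v\<in>?G. m (v - s) * busemann s x v) - (\<Sum>u\<in>F. m u * busemann s x u) = 1"
      using total by simp
    moreover have "ennreal ((\<Sum>v\<in>?G. m (v - s) * busemann s x v) - (\<Sum>u\<in>F. m u * busemann s x u))
        \<le> transport_cost (cayley S) A"
    proof (rule transport_cost_ge[OF A F m0])
      show "finite ?G"
        using F by simp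
      show "m (v - s) = 0" if "v \<notin> ?G" for v
        using that by (intro m0) (auto simp: image_iff)
      show "ennreal (busemann s x v - busemann s x u)
          \<le> ennreal_of_enat (graph_dist (cayley S) u v)" if "u \<in> F" for u v
        using walk[OF that] busemann_lipschitz[OF s] by (intro le_graph_distI) blast
    qed
    ultimately show ?thesis by simp
  qed
  have "transport_cost (cayley S) (\<lambda>u v. if v = u + s then m u else 0) = 1"
    using transport_cost_translation[OF F m0 nn dist_generator[OF s]] total by simp
  then have "wasserstein (cayley S) m (\<lambda>v. m (v - s)) = 1"
    unfolding wasserstein_def using translation_coupling[of m s, OF nn] lower
    by (intro antisym Inf_lower Inf_greatest) (force, blast)
  then show ?thesis
    by (simp add: trans m_def)
qed

lemma ricci_flat_cayley: "ricci_flat (cayley S)"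
  unfolding ricci_flat_def has_ricci_curvature_def
proof (intro allI impI)
  fix x y assume "cayley S x y"
  then obtain s where s: "s \<in> S" "y = x + s"
    unfolding cayley_def by (metis add.commute diff_add_cancel)
  \<comment> \<open>Only \<alpha> just below 1 matters for the limit; there
    \<open>wasserstein_edge\<close> applies and the quotient is constantly 0.\<close>
  have "\<forall>\<^sub>F \<alpha> in at_left (1::real). \<alpha> \<in> {0<..<1}"
    by (rule eventually_at_leftI) auto
  then have "\<forall>\<^sub>F \<alpha> in at_left 1. alpha_curvature (cayley S) \<alpha> x y / (1 - \<alpha>) = 0"
    by eventually_elim
      (simp add: alpha_curvature_def s wasserstein_edge dist_generator one_enat_def)
  then show "((\<lambda>\<alpha>. alpha_curvature (cayley S) \<alpha> x y / (1 - \<alpha>)) \<longlongrightarrow> 0) (at_left 1)"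
    by (rule tendsto_eventually)
qed

end

theorem theorem2:
  fixes S :: "'a::ab_group_add set"
  assumes "torsion_free TYPE('a)"
    and "finite S"
    and "S = uminus ` S"
    and "\<And>x s n. s \<in> S \<Longrightarrow> n \<ge> 1 \<Longrightarrow>
           graph_dist (cayley S) x (x + nat_multiple n s) = enat n"
  shows "ricci_flat (cayley S)"
proof -
  interpret geodesic_cayley S
    by unfold_locales (use assms in auto)
  show ?thesis
    by (rule ricci_flat_cayley)
qed

end
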